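(* Let $p>2$ and let $f_p:\mathbb{R}\to\mathbb{R}$ be defined by $$f_p(u):=\frac{|u|^p-pu+(p-1)}{(p-1)|u|^p-p\operatorname{sgn}(u)|u|^{p-1}+1}\quad\text{if }u\neq1,\qquad f_p(1):=1.$$ Then, for the function $|\cdot|^p:\mathbb{R}\to\mathbb{R}$, $\alpha(|\cdot|^p)>0$ and $$\alpha(|\cdot|^p)=\Bigl(\max\{f_p(u)\mid u\in(-1,0)\}\Bigr)^{-1}.$$
   Context: For a differentiable strictly convex function $h:\mathbb{R}\to\mathbb{R}$ (such as $|\cdot|^p$ with $p>1$), the Bregman distance is $D_h(x,y):=h(x)-h(y)-h'(y)(x-y)$ and the symmetry coefficient is $$\alpha(h):=\inf\left\{\frac{D_h(x,y)}{D_h(y,x)}\;\middle|\;x,y\in\mathbb{R},\ x\neq y\right\}.$$ The denominator in the definition of $f_p$ is positive for every $u\neq 1$. *)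

theory Defs
  imports "HOL-Analysis.Analysis"
begin

definition bregman :: "(real \<Rightarrow> real) \<Rightarrow> real \<Rightarrow> real \<Rightarrow> real" where
  "bregman h x y = h x - h y - deriv h y * (x - y)"

text \<open>For a differentiable strictly convex \<open>h\<close>, every Bregman distance between distinct points is
  positive, so the infimum is taken over a nonempty set of reals bounded below by \<open>0\<close>. For other
  \<open>h\<close> the value carries no meaning.\<close>

definition symmetry_coeff :: "(real \<Rightarrow> real) \<Rightarrow> real" where
  "symmetry_coeff h = Inf {bregman h x y / bregman h y x | x y. x \<noteq> y}"

definition f_p :: "real \<Rightarrow> real \<Rightarrow> real" where
  "f_p p u =
    (if u = 1 then 1
     else (\<bar>u\<bar> powr p - p * u + (p - 1)) /
          ((p - 1) * \<bar>u\<bar> powr p - p * sgn u * \<bar>u\<bar> powr (p - 1) + 1))"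

end

theory Submission
  imports Defs
begin

text \<open>
  Write \<open>h = \<bar>\<cdot>\<bar> powr p\<close> and let \<open>D\<close> be its Bregman distance. Since \<open>h\<close> is homogeneous of degree
  \<open>p\<close>, so is \<open>D\<close>, jointly in both arguments (\<open>bregman_abs_powr_scale\<close>). Hence for \<open>y \<noteq> 0\<close> the ratio
  \<open>D x y / D y x\<close> depends only on \<open>x / y\<close>, and it is \<open>f_p p (x / y)\<close> (\<open>bregman_ratio_eq_f_p\<close>).
  Swapping the arguments inverts the ratio, and all Bregman distances between distinct points are
  positive (\<open>bregman_abs_powr_pos\<close>), so the smallest ratio is the inverse of the largest value of
  \<open>f_p p\<close>. Pairs with \<open>x = 0\<close> escape this argument, because \<open>y / x\<close> is then meaningless, but they
  contribute only the ratio \<open>f_p p 0 = p - 1 > 1\<close>, which is never the smallest.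

  It remains to see that \<open>f_p p\<close> has a global maximum and that it lies in \<open>(-1, 0)\<close>
  (\<open>f_p_attains_max\<close>). The value to compare with is \<open>f_p p 0 = p - 1\<close>. For \<open>u \<ge> 0\<close> the inequality
  \<open>f_p p u \<le> p - 1\<close> turns out to be positivity of the Bregman distance for the exponent \<open>p - 1\<close>,
  which exceeds \<open>1\<close>; for \<open>u \<le> -1\<close> even \<open>f_p p u \<le> 1\<close>. Immediately to the left of \<open>0\<close>,
  the term \<open>- p * u\<close> of the numerator is of first order while the denominator grows only at order
  \<open>p - 1 > 1\<close>, so \<open>f_p p\<close> exceeds \<open>p - 1\<close> there. Therefore the maximum over the compact interval
  \<open>[-1, 0]\<close>, which exists by continuity, is global and is not taken at an endpoint.
\<close>

section \<open>Bregman distances of absolute powers\<close>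

lemma DERIV_abs_powr:
  fixes p x :: real
  assumes "p > 1"
  shows "((\<lambda>x. \<bar>x\<bar> powr p) has_real_derivative p * sgn x * \<bar>x\<bar> powr (p - 1)) (at x)"
proof -
  consider "x > 0" | "x < 0" | "x = 0" by linarith
  then show ?thesis
  proof cases
    case 1
    have "((\<lambda>x. x powr p) has_real_derivative p * x powr (p - 1)) (at x)"
      using 1 by (auto intro!: derivative_eq_intros simp: powr_diff)
    then have "((\<lambda>x. \<bar>x\<bar> powr p) has_real_derivative p * x powr (p - 1)) (at x)"
      by (rule has_field_derivative_transform_within_open[where S = "{0<..}"]) (use 1 in auto)
    with 1 show ?thesis by simp
  next
    case 2
    have "((\<lambda>x. (-x) powr p) has_real_derivative - (p * (-x) powr (p - 1))) (at x)"
      using 2 by (auto intro!: derivative_eq_intros simp: powr_diff)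
    then have "((\<lambda>x. \<bar>x\<bar> powr p) has_real_derivative - (p * (-x) powr (p - 1))) (at x)"
      by (rule has_field_derivative_transform_within_open[where S = "{..<0}"]) (use 2 in auto)
    with 2 show ?thesis by simp
  next
    case 3
    \<comment> \<open>At the kink of the absolute value, the difference quotient is \<open>sgn t * \<bar>t\<bar> powr (p - 1)\<close>.\<close>
    have "((\<lambda>t. sgn t * \<bar>t\<bar> powr (p - 1)) \<longlongrightarrow> 0) (at (0::real))"
    proof (rule Lim_null_comparison)
      have "((\<lambda>t. \<bar>t\<bar> powr (p - 1)) \<longlongrightarrow> \<bar>0\<bar> powr (p - 1)) (at (0::real))"
        using assms by (intro tendsto_powr' tendsto_rabs tendsto_ident_at tendsto_const) auto
      then show "((\<lambda>t. \<bar>t\<bar> powr (p - 1)) \<longlongrightarrow> 0) (at (0::real))" by simp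
      show "\<forall>\<^sub>F t in at (0::real). norm (sgn t * \<bar>t\<bar> powr (p - 1)) \<le> \<bar>t\<bar> powr (p - 1)"
        by (auto simp: abs_mult sgn_if)
    qed
    moreover have "\<forall>\<^sub>F t in at (0::real). sgn t * \<bar>t\<bar> powr (p - 1) = \<bar>t\<bar> powr p / t"
      by (auto simp: eventually_at_filter powr_diff sgn_if)
    ultimately have "((\<lambda>t. \<bar>t\<bar> powr p / t) \<longlongrightarrow> 0) (at (0::real))"
      by (rule Lim_transform_eventually)
    then show ?thesis
      using 3 by (simp add: DERIV_def)
  qed
qed

lemma bregman_abs_powr:
  assumes "p > 1"
  shows "bregman (\<lambda>x. \<bar>x\<bar> powr p) x y =
           \<bar>x\<bar> powr p - \<bar>y\<bar> powr p - p * sgn y * \<bar>y\<bar> powr (p - 1) * (x - y)"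
  by (simp add: bregman_def DERIV_imp_deriv[OF DERIV_abs_powr[OF assms]])

lemma strict_mono_sgn_powr:
  fixes a :: real
  assumes "a > 0"
  shows "strict_mono (\<lambda>x. sgn x * \<bar>x\<bar> powr a)"
proof (rule strict_monoI)
  fix x y :: real assume "x < y"
  consider "x \<ge> 0" | "y \<le> 0" | "x < 0" "0 < y" by linarith
  then show "sgn x * \<bar>x\<bar> powr a < sgn y * \<bar>y\<bar> powr a"
  proof cases
    case 1
    then show ?thesis
      using powr_less_mono2[OF assms 1 \<open>x < y\<close>] \<open>x < y\<close> by (auto simp: sgn_if)
  next
    case 2
    then show ?thesis
      using powr_less_mono2[OF assms, of "-y" "-x"] \<open>x < y\<close> by (auto simp: sgn_if)
  next
    case 3
    then have "sgn x * \<bar>x\<bar> powr a < 0" "0 < sgn y * \<bar>y\<bar> powr a" by auto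
    then show ?thesis by (rule less_trans)
  qed
qed

text \<open>
  By the mean value theorem \<open>h x - h y = h' z * (x - y)\<close> with \<open>z\<close> strictly between \<open>x\<close> and \<open>y\<close>, and
  \<open>h' z - h' y\<close> has the sign of \<open>x - y\<close>. This is strict convexity of \<open>h\<close> in the form of a strictly
  increasing derivative.
\<close>

lemma bregman_pos:
  assumes deriv: "\<And>x. (h has_real_derivative h' x) (at x)"
    and mono: "strict_mono h'" and "x \<noteq> y"
  shows "bregman h x y > 0"
proof -
  have D: "bregman h x y = h x - h y - h' y * (x - y)"
    by (simp add: bregman_def DERIV_imp_deriv[OF deriv])
  consider "x < y" | "y < x" using \<open>x \<noteq> y\<close> by linarith
  then show ?thesis
  proof cases
    case 1
    then obtain z where z: "z < y" "h y - h x = (y - x) * h' z"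
      using MVT2[OF 1, of h h'] deriv by blast
    have "h' z < h' y" using mono z by (simp add: strict_monoD)
    then have "(y - x) * h' z < (y - x) * h' y" using 1 by simp
    then show ?thesis using D z by (simp add: algebra_simps)
  next
    case 2
    then obtain z where z: "y < z" "h x - h y = (x - y) * h' z"
      using MVT2[OF 2, of h h'] deriv by blast
    have "h' y < h' z" using mono z by (simp add: strict_monoD)
    then have "(x - y) * h' y < (x - y) * h' z" using 2 by simp
    then show ?thesis using D z by (simp add: algebra_simps)
  qed
qed

lemma bregman_abs_powr_pos:
  assumes "p > 1" and "x \<noteq> y"
  shows "bregman (\<lambda>x. \<bar>x\<bar> powr p) x y > 0"
proof (rule bregman_pos[OF _ _ \<open>x \<noteq> y\<close>])
  show "((\<lambda>x. \<bar>x\<bar> powr p) has_real_derivative p * (sgn x * \<bar>x\<bar> powr (p - 1))) (at x)" for x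
    using DERIV_abs_powr[OF \<open>p > 1\<close>, of x] by (simp add: mult.assoc)
  show "strict_mono (\<lambda>x. p * (sgn x * \<bar>x\<bar> powr (p - 1)))"
    using strict_mono_sgn_powr[of "p - 1"] \<open>p > 1\<close> by (simp add: strict_mono_def)
qed

lemma sgn_times_abs_powr: "sgn u * u * \<bar>u\<bar> powr (p - 1) = \<bar>u\<bar> powr p" for u p :: real
  by (cases "u = 0") (auto simp: powr_diff sgn_if)

lemma bregman_abs_powr_scale:
  assumes "p > 1"
  shows "bregman (\<lambda>x. \<bar>x\<bar> powr p) (c * x) (c * y) =
           \<bar>c\<bar> powr p * bregman (\<lambda>x. \<bar>x\<bar> powr p) x y"
proof -
  have "\<bar>c * y\<bar> powr (p - 1) * (sgn (c * y) * c) = \<bar>c\<bar> powr p * (sgn y * \<bar>y\<bar> powr (p - 1))"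
    using sgn_times_abs_powr[of c p] by (simp add: abs_mult powr_mult sgn_mult mult_ac)
  then have "p * sgn (c * y) * \<bar>c * y\<bar> powr (p - 1) * (c * x - c * y) =
      \<bar>c\<bar> powr p * (p * sgn y * \<bar>y\<bar> powr (p - 1) * (x - y))"
    by (metis (no_types, opaque_lifting) mult.assoc mult.commute right_diff_distrib)
  then show ?thesis
    by (simp add: bregman_abs_powr[OF assms] abs_mult powr_mult right_diff_distrib)
qed

section \<open>The ratio of swapped Bregman distances\<close>

text \<open>
  With one of the two points normalised to \<open>1\<close>, the two distances are the numerator and the denominator
  of \<open>f_p\<close>.
\<close>

lemma bregman_1_right:
  assumes "p > 1"
  shows "bregman (\<lambda>x. \<bar>x\<bar> powr p) u 1 = \<bar>u\<bar> powr p - p * u + (p - 1)"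
  using assms by (simp add: bregman_abs_powr algebra_simps)

lemma bregman_1_left:
  assumes "p > 1"
  shows "bregman (\<lambda>x. \<bar>x\<bar> powr p) 1 u =
           (p - 1) * \<bar>u\<bar> powr p - p * sgn u * \<bar>u\<bar> powr (p - 1) + 1"
proof -
  have "p * sgn u * \<bar>u\<bar> powr (p - 1) * u = p * \<bar>u\<bar> powr p"
    using sgn_times_abs_powr[of u p] by (simp add: mult_ac)
  then show ?thesis
    using assms by (simp add: bregman_abs_powr algebra_simps)
qed

lemma bregman_ratio_eq_f_p:
  assumes "p > 1" and "y \<noteq> 0" and "x \<noteq> y"
  shows "bregman (\<lambda>x. \<bar>x\<bar> powr p) x y / bregman (\<lambda>x. \<bar>x\<bar> powr p) y x = f_p p (x / y)"
proof -
  have "x / y \<noteq> 1" using assms by simp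
  then show ?thesis
    using bregman_abs_powr_scale[OF \<open>p > 1\<close>, of y "x / y" 1]
      bregman_abs_powr_scale[OF \<open>p > 1\<close>, of y 1 "x / y"] assms
    by (simp add: f_p_def bregman_1_left bregman_1_right)
qed

lemma f_p_denominator_pos:
  fixes p u :: real
  assumes "p > 1" and "u \<noteq> 1"
  shows "(p - 1) * \<bar>u\<bar> powr p - p * sgn u * \<bar>u\<bar> powr (p - 1) + 1 > 0"
  using bregman_abs_powr_pos[of p 1 u] assms by (simp add: bregman_1_left)

lemma f_p_pos:
  assumes "p > 1"
  shows "f_p p u > 0"
  using bregman_abs_powr_pos[of p u 1] f_p_denominator_pos[of p u] assms
  by (simp add: f_p_def bregman_1_right)

section \<open>The maximum of the ratio function\<close>

lemma f_p_0: "f_p p 0 = p - 1"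
  by (simp add: f_p_def)

text \<open>
  After clearing denominators, \<open>f_p p u \<le> p - 1\<close> becomes \<open>p * u\<close> times the inequality
  \<open>(p - 2) * u powr (p - 1) - (p - 1) * u powr (p - 2) + 1 \<ge> 0\<close>, whose left-hand side is the
  denominator of \<open>f_p (p - 1)\<close>, that is, a Bregman distance for the exponent \<open>p - 1 > 1\<close>.
\<close>

lemma f_p_le_on_nonneg:
  assumes "p > 2" and "u \<ge> 0"
  shows "f_p p u \<le> p - 1"
proof (cases "u = 0 \<or> u = 1")
  case True
  then show ?thesis using assms by (auto simp: f_p_def)
next
  case False
  with assms have u: "u > 0" "u \<noteq> 1" by auto
  have "(p - 2) * u powr (p - 1) - (p - 1) * u powr (p - 2) + 1 > 0"
    using f_p_denominator_pos[of "p - 1" u] assms u by simp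
  then have "0 \<le> p * u * ((p - 2) * u powr (p - 1) - (p - 1) * u powr (p - 2) + 1)"
    using assms u by simp
  also have "\<dots> = p * (p - 2) * (u * u powr (p - 1)) - p * (p - 1) * (u * u powr (p - 2)) + p * u"
    by (simp add: algebra_simps)
  also have "\<dots> = p * (p - 2) * u powr p - p * (p - 1) * u powr (p - 1) + p * u"
    using u by (simp add: powr_mult_base)
  finally have "u powr p - p * u + (p - 1) \<le>
      (p - 1) * ((p - 1) * u powr p - p * u powr (p - 1) + 1)"
    by (simp add: algebra_simps)
  then show ?thesis
    using f_p_denominator_pos[of p u] assms u by (simp add: f_p_def divide_le_eq)
qed

text \<open>
  With \<open>t = -u \<ge> 1\<close>, denominator minus numerator is
  \<open>(p - 2) * (t powr p - 1) + p * (t powr (p - 1) - t)\<close>, and both summands are nonnegative.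
\<close>

lemma f_p_le_1_below_minus_1:
  assumes "p > 2" and "u \<le> -1"
  shows "f_p p u \<le> 1"
proof -
  define t where "t = -u"
  have t: "t \<ge> 1" "u = -t" using assms by (auto simp: t_def)
  have "t powr 0 \<le> t powr p" "t powr 1 \<le> t powr (p - 1)"
    using assms t(1) by (intro powr_mono; simp)+
  then have "(p - 2) * 1 \<le> (p - 2) * t powr p" "p * t \<le> p * t powr (p - 1)"
    using assms t by (auto intro!: mult_left_mono)
  then have "t powr p + p * t + (p - 1) \<le> (p - 1) * t powr p + p * t powr (p - 1) + 1"
    by (simp add: algebra_simps)
  then show ?thesis
    using f_p_denominator_pos[of p u] assms t by (simp add: f_p_def)
qed

text \<open>
  With \<open>t = -u > 0\<close>, clearing denominators in \<open>f_p p u > p - 1\<close> and dividing by \<open>p * t\<close> leaves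
  \<open>(p - 2) * t powr (p - 1) + (p - 1) * t powr (p - 2) < 1\<close>. Both exponents are positive, so this
  holds for all small \<open>t\<close>.
\<close>

lemma f_p_exceeds_value_at_0:
  assumes "p > 2"
  obtains u where "-1 < u" "u < 0" "f_p p u > p - 1"
proof -
  \<comment> \<open>Chosen so that \<open>t powr (p - 2) = 1 / (2 * p)\<close>; the sum above is then at most
    \<open>(2 * p - 3) / (2 * p)\<close>.\<close>
  define t where "t = (1 / (2 * p)) powr (1 / (p - 2))"
  have t: "t > 0" "t powr (p - 2) = 1 / (2 * p)"
    using assms by (auto simp: t_def powr_powr)
  have "t < 1 powr (1 / (p - 2))"
    unfolding t_def using assms by (intro powr_less_mono2) auto
  then have t1: "t < 1" by simp
  have "t powr (p - 1) \<le> t powr (p - 2)"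
    using t t1 by (intro powr_mono') auto
  then have "(p - 2) * t powr (p - 1) + (p - 1) * t powr (p - 2)
      \<le> (p - 2) * (1 / (2 * p)) + (p - 1) * (1 / (2 * p))"
    using assms t by (intro add_mono mult_left_mono) auto
  also have "\<dots> < 1" using assms by (simp add: field_simps)
  finally have "p * t * ((p - 2) * t powr (p - 1) + (p - 1) * t powr (p - 2)) < p * t * 1"
    using assms t by (intro mult_strict_left_mono) auto
  also have "p * t * ((p - 2) * t powr (p - 1) + (p - 1) * t powr (p - 2))
      = p * (p - 2) * (t * t powr (p - 1)) + p * (p - 1) * (t * t powr (p - 2))"
    by (simp add: algebra_simps)
  also have "\<dots> = p * (p - 2) * t powr p + p * (p - 1) * t powr (p - 1)"
    using t(1) by (simp add: powr_mult_base)
  finally have "(p - 1) * ((p - 1) * t powr p + p * t powr (p - 1) + 1)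
      < t powr p + p * t + (p - 1)"
    by (simp add: algebra_simps)
  then have "f_p p (-t) > p - 1"
    using f_p_denominator_pos[of p "-t"] assms t by (simp add: f_p_def less_divide_eq)
  with that[of "-t"] t t1 show ?thesis by simp
qed

lemma continuous_on_f_p:
  assumes "p > 1"
  shows "continuous_on {-1..0} (f_p p)"
proof -
  have powr: "continuous_on {-1..0} (\<lambda>u::real. \<bar>u\<bar> powr a)" if "a > 0" for a
    using that by (intro continuous_on_powr' continuous_on_rabs continuous_on_const continuous_on_id) auto
  \<comment> \<open>For \<open>u \<le> 0\<close> the sign function disappears, and all terms of the denominator become nonnegative.\<close>
  have "continuous_on {-1..0} (\<lambda>u. (\<bar>u\<bar> powr p - p * u + (p - 1)) /
          ((p - 1) * \<bar>u\<bar> powr p + p * \<bar>u\<bar> powr (p - 1) + 1))"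
  proof (intro continuous_on_divide continuous_on_add continuous_on_diff
      continuous_on_mult continuous_on_const continuous_on_id powr ballI)
    fix u :: real
    have "(p - 1) * \<bar>u\<bar> powr p + p * \<bar>u\<bar> powr (p - 1) + 1 > 0"
      using assms by (intro add_nonneg_pos add_nonneg_nonneg) auto
    then show "(p - 1) * \<bar>u\<bar> powr p + p * \<bar>u\<bar> powr (p - 1) + 1 \<noteq> 0" by simp
  qed (use assms in auto)
  then show ?thesis
    by (rule continuous_on_eq) (auto simp: f_p_def sgn_if)
qed

text \<open>
  A point of \<open>(-1, 0)\<close> where \<open>f_p p\<close> exceeds \<open>p - 1\<close> forces the maximum over \<open>[-1, 0]\<close> above \<open>p - 1\<close>,
  hence above the values at both endpoints and everywhere outside the interval.
\<close>

lemma f_p_attains_max: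
  assumes "p > 2"
  obtains u where "u \<in> {-1<..<0}" and "\<And>v. f_p p v \<le> f_p p u"
proof -
  obtain u where u: "u \<in> {-1..0}" and max: "\<And>v. v \<in> {-1..0} \<Longrightarrow> f_p p v \<le> f_p p u"
    using continuous_attains_sup[OF compact_Icc, of "-1" 0 "f_p p"] continuous_on_f_p[of p] assms
    by fastforce
  obtain w where w: "-1 < w" "w < 0" "f_p p w > p - 1"
    using f_p_exceeds_value_at_0[OF assms] .
  then have big: "f_p p u > p - 1" using max[of w] by simp
  have "u \<noteq> -1" using big f_p_le_1_below_minus_1[of p "-1"] assms by auto
  moreover have "u \<noteq> 0" using big by (auto simp: f_p_0)
  ultimately have "u \<in> {-1<..<0}" using u by auto
  moreover have "f_p p v \<le> f_p p u" for v
  proof -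
    consider "v \<ge> 0" | "v \<le> -1" | "v \<in> {-1..0}" by fastforce
    then show ?thesis
      using f_p_le_on_nonneg[of p v] f_p_le_1_below_minus_1[of p v] max[of v] big assms by cases auto
  qed
  ultimately show ?thesis using that by blast
qed

section \<open>The symmetry coefficient\<close>

theorem corollary4p2:
  fixes p :: real
  assumes "p > 2"
  shows "symmetry_coeff (\<lambda>x. \<bar>x\<bar> powr p) > 0 \<and>
    (\<exists>m. m \<in> f_p p ` {-1<..<0} \<and> (\<forall>v \<in> f_p p ` {-1<..<0}. v \<le> m) \<and>
         symmetry_coeff (\<lambda>x. \<bar>x\<bar> powr p) = inverse m)"
proof -
  let ?B = "bregman (\<lambda>x. \<bar>x\<bar> powr p)"
  have p: "p > 1" using assms by simp
  obtain u where u: "u \<in> {-1<..<0}" and max: "\<And>v. f_p p v \<le> f_p p u"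
    using f_p_attains_max[OF assms] by blast
  have pos: "f_p p u > 0" using f_p_pos[OF p] .
  have inv: "?B x y / ?B y x = inverse (f_p p (y / x))" if "x \<noteq> 0" "x \<noteq> y" for x y
    using bregman_ratio_eq_f_p[OF p that(1), of y] that by (metis inverse_divide)
  have "symmetry_coeff (\<lambda>x. \<bar>x\<bar> powr p) = inverse (f_p p u)"
    unfolding symmetry_coeff_def
  proof (rule cInf_eq_minimum)
    show "inverse (f_p p u) \<in> {?B x y / ?B y x |x y. x \<noteq> y}"
      using inv[of 1 u] u by (intro CollectI exI[of _ 1] exI[of _ u]) auto
  next
    fix r assume "r \<in> {?B x y / ?B y x |x y. x \<noteq> y}"
    then obtain x y where r: "r = ?B x y / ?B y x" and "x \<noteq> y" by blast
    show "inverse (f_p p u) \<le> r"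
    proof (cases "x = 0")
      case True
      then have "r = p - 1"
        using bregman_ratio_eq_f_p[OF p, of y x] \<open>x \<noteq> y\<close> r by (simp add: f_p_0)
      moreover have "inverse (f_p p u) \<le> 1"
        using max[of 0] assms pos by (simp add: f_p_0 inverse_le_1_iff)
      ultimately show ?thesis using assms by simp
    next
      case False
      then show ?thesis
        using inv[OF False \<open>x \<noteq> y\<close>] max f_p_pos[OF p] r by (simp add: le_imp_inverse_le)
    qed
  qed
  then show ?thesis using u max pos by (intro conjI exI[of _ "f_p p u"]) auto
qed

end
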